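(* Let $\mathcal{H}$ be a regular unitarily invariant space of holomorphic functions on $\mathbb{B}_d$ whose reproducing kernel has non-negative real part. If $f \in \mathcal{H}$ is cyclic, then $\operatorname{cap}_{\mathcal{H}}(Z(f^* )) = 0$, where $\operatorname{cap}_{\mathcal{H}}$ denotes inner $\mathcal{H}$-capacity.
   Context: $\mathbb{B}_d$ is the open Euclidean unit ball of $\mathbb{C}^d$ ($d \ge 1$), with boundary sphere $\partial\mathbb{B}_d$. A regular unitarily invariant space of holomorphic functions on $\mathbb{B}_d$ is a reproducing kernel Hilbert space $\mathcal{H}$ on $\mathbb{B}_d$ with kernel $K(z,w) = \sum_{n=0}^\infty a_n\langle z,w\rangle^n$, where $a_n > 0$ for all $n \ge 0$, $a_0 = 1$ and $\lim_{n\to\infty} a_n/a_{n+1} = 1$. Polynomials are multipliers of such a space. A function $f \in \mathcal{H}$ is cyclic if $\{\varphi f : \varphi \in \operatorname{Mult}(\mathcal{H})\}$ is dense in $\mathcal{H}$ (equivalently, $\{pf : p \text{ polynomial}\}$ is dense in $\mathcal{H}$), where $\operatorname{Mult}(\mathcal{H})$ is the multiplier algebra of $\mathcal{H}$. The $\mathcal{H}$-energy of a Borel probability measure $\mu$ on $\partial\mathbb{B}_d$ is $\mathcal{E}(\mu) = \sup_{0 \le r < 1} \int\int K(rz,rw)\, d\mu(w)\, d\mu(z) \in [0,\infty]$ (the double integrals are non-negative reals, increasing in $r$). For compact $F \subset \partial\mathbb{B}_d$, $\operatorname{cap}_{\mathcal{H}}(F) = \sup\{1/\mathcal{E}(\mu)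 : \mu$ a Borel probability measure supported on $F\}$ (with $1/\infty = 0$ and $\operatorname{cap}(\emptyset) = 0$). For arbitrary $E \subset \partial\mathbb{B}_d$, the inner capacity is $\operatorname{cap}_{\mathcal{H}}(E) = \sup\{\operatorname{cap}_{\mathcal{H}}(F) : F \subset E \text{ compact}\}$ and the outer capacity is $\operatorname{cap}^*_{\mathcal{H}}(E) = \inf\{\operatorname{cap}_{\mathcal{H}}(G) : G \supset E,\ G \text{ open in } \partial\mathbb{B}_d\}$. Boundary function: for every $f \in \mathcal{H}$ there is a Borel function $f^* : \partial\mathbb{B}_d \to \mathbb{C}$, unique outside a Borel set of outer $\mathcal{H}$-capacity zero, such that for every $\varepsilon > 0$, $\operatorname{cap}^*_{\mathcal{H}}(\{\zeta : |f^*(\zeta) - f(r\zeta)| \ge \varepsilon\}) \to 0$ as $r \nearrow 1$; moreover $f(r_n\,\cdot) \to f^*$ pointwise outside a Borel set of outer capacity zero for some sequence $r_n \to 1$. Fix any such $f^*$ and put $Z(f^* ) = \{\zeta \in \partial\mathbb{B}_d : f^*(\zeta) = 0\}$. *)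

theory Defs
  imports "HOL-Probability.Probability"
begin

section \<open>Reproducing kernel Hilbert spaces of complex-valued functions\<close>

text \<open>
  Functions on a set \<open>X\<close> are represented by total functions vanishing outside \<open>X\<close>, so that
  equality of elements of \<open>H\<close> is equality of functions on \<open>X\<close>. The inner product \<open>ip\<close> is linear in
  its first argument; its values outside \<open>H\<close> are irrelevant.
\<close>

definition on_set :: "'x set \<Rightarrow> ('x \<Rightarrow> complex) \<Rightarrow> 'x \<Rightarrow> complex" where
  "on_set X f = (\<lambda>x. if x \<in> X then f x else 0)"

definition ip_norm :: "(('x \<Rightarrow> complex) \<Rightarrow> ('x \<Rightarrow> complex) \<Rightarrow> complex) \<Rightarrow> ('x \<Rightarrow> complex) \<Rightarrow> real" where
  "ip_norm ip f = sqrt (Re (ip f f))"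

locale rkhs =
  fixes X :: "'x set"
    and H :: "('x \<Rightarrow> complex) set"
    and ip :: "('x \<Rightarrow> complex) \<Rightarrow> ('x \<Rightarrow> complex) \<Rightarrow> complex"
    and K :: "'x \<Rightarrow> 'x \<Rightarrow> complex"
  assumes vanishes_off: "\<lbrakk>f \<in> H; x \<notin> X\<rbrakk> \<Longrightarrow> f x = 0"
    and zero_closed: "(\<lambda>x. 0) \<in> H"
    and add_closed: "\<lbrakk>f \<in> H; g \<in> H\<rbrakk> \<Longrightarrow> (\<lambda>x. f x + g x) \<in> H"
    and scale_closed: "f \<in> H \<Longrightarrow> (\<lambda>x. c * f x) \<in> H"
    and ip_add: "\<lbrakk>f \<in> H; g \<in> H; h \<in> H\<rbrakk> \<Longrightarrow> ip (\<lambda>x. f x + g x) h = ip f h + ip g h"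
    and ip_scale: "\<lbrakk>f \<in> H; h \<in> H\<rbrakk> \<Longrightarrow> ip (\<lambda>x. c * f x) h = c * ip f h"
    and ip_cnj: "\<lbrakk>f \<in> H; g \<in> H\<rbrakk> \<Longrightarrow> ip g f = cnj (ip f g)"
    and ip_nonneg: "f \<in> H \<Longrightarrow> 0 \<le> Re (ip f f)"
    and ip_definite: "\<lbrakk>f \<in> H; ip f f = 0\<rbrakk> \<Longrightarrow> f = (\<lambda>x. 0)"
    and complete:
      "\<lbrakk>\<forall>n. s n \<in> H;
        \<forall>\<epsilon>>0. \<exists>N. \<forall>m\<ge>N. \<forall>n\<ge>N. ip_norm ip (\<lambda>x. s m x - s n x) < \<epsilon>\<rbrakk>
       \<Longrightarrow> \<exists>f\<in>H. (\<lambda>n. ip_norm ip (\<lambda>x. s n x - f x)) \<longlonglongrightarrow> 0"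
    and kernel_mem: "w \<in> X \<Longrightarrow> on_set X (\<lambda>z. K z w) \<in> H"
    and reproducing: "\<lbrakk>f \<in> H; w \<in> X\<rbrakk> \<Longrightarrow> ip f (on_set X (\<lambda>z. K z w)) = f w"

definition Mult :: "'x set \<Rightarrow> ('x \<Rightarrow> complex) set \<Rightarrow> ('x \<Rightarrow> complex) set" where
  "Mult X H = {\<phi>. (\<forall>x. x \<notin> X \<longrightarrow> \<phi> x = 0) \<and> (\<forall>f\<in>H. (\<lambda>x. \<phi> x * f x) \<in> H)}"

definition cyclic ::
  "'x set \<Rightarrow> ('x \<Rightarrow> complex) set \<Rightarrow> (('x \<Rightarrow> complex) \<Rightarrow> ('x \<Rightarrow> complex) \<Rightarrow> complex) \<Rightarrow>
   ('x \<Rightarrow> complex) \<Rightarrow> bool" where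
  "cyclic X H ip f \<longleftrightarrow>
     f \<in> H \<and> (\<forall>g\<in>H. \<forall>\<epsilon>>0. \<exists>\<phi>\<in>Mult X H. ip_norm ip (\<lambda>x. \<phi> x * f x - g x) < \<epsilon>)"

section \<open>Regular unitarily invariant spaces on the unit ball\<close>

definition herm :: "complex ^ 'd \<Rightarrow> complex ^ 'd \<Rightarrow> complex" where
  "herm z w = (\<Sum>i\<in>UNIV. z $ i * cnj (w $ i))"

definition ui_kernel :: "(nat \<Rightarrow> real) \<Rightarrow> complex ^ 'd \<Rightarrow> complex ^ 'd \<Rightarrow> complex" where
  "ui_kernel a z w = (\<Sum>n. complex_of_real (a n) * herm z w ^ n)"

locale regular_unitarily_invariant_space =
  rkhs "ball (0 :: complex ^ 'd) 1" H ip "ui_kernel a"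
  for H :: "(complex ^ 'd \<Rightarrow> complex) set"
    and ip :: "(complex ^ 'd \<Rightarrow> complex) \<Rightarrow> (complex ^ 'd \<Rightarrow> complex) \<Rightarrow> complex"
    and a :: "nat \<Rightarrow> real" +
  assumes coeff_pos: "0 < a n"
    and coeff_0: "a 0 = 1"
    and coeff_regular: "(\<lambda>n. a n / a (Suc n)) \<longlonglongrightarrow> 1"

section \<open>Energy and capacity\<close>

text \<open>
  For a probability measure on the sphere the double integrals below are non-negative reals, so
  neither taking real parts nor the coercion to \<^typ>\<open>ennreal\<close> loses information.
\<close>

definition energy :: "(nat \<Rightarrow> real) \<Rightarrow> (complex ^ 'd) measure \<Rightarrow> ennreal" where
  "energy a \<mu> =
     (SUP r\<in>{0..<1::real}.
        ennreal (Re (\<integral>z. (\<integral>w. ui_kernel a (r *\<^sub>R z) (r *\<^sub>R w) \<partial>\<mu>) \<partial>\<mu>)))"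

definition sphere_probs :: "(complex ^ 'd) set \<Rightarrow> (complex ^ 'd) measure set" where
  "sphere_probs F =
     {\<mu>. prob_space \<mu> \<and> sets \<mu> = sets (restrict_space borel (sphere 0 1)) \<and>
         emeasure \<mu> (sphere 0 1 - F) = 0}"

text \<open>In \<^typ>\<open>ennreal\<close>, \<open>1 / \<infinity> = 0\<close> and the supremum of the empty set is \<open>0\<close>.\<close>

definition compact_cap :: "(nat \<Rightarrow> real) \<Rightarrow> (complex ^ 'd) set \<Rightarrow> ennreal" where
  "compact_cap a F = (SUP \<mu>\<in>sphere_probs F. 1 / energy a \<mu>)"

definition inner_cap :: "(nat \<Rightarrow> real) \<Rightarrow> (complex ^ 'd) set \<Rightarrow> ennreal" where
  "inner_cap a E = (SUP F\<in>{F. compact F \<and> F \<subseteq> E}. compact_cap a F)"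

definition outer_cap :: "(nat \<Rightarrow> real) \<Rightarrow> (complex ^ 'd) set \<Rightarrow> ennreal" where
  "outer_cap a E =
     (INF G\<in>{G. openin (top_of_set (sphere 0 1)) G \<and> E \<subseteq> G}. inner_cap a G)"

text \<open>Only the values of \<open>fs\<close> on the sphere matter.\<close>

definition boundary_function ::
  "(nat \<Rightarrow> real) \<Rightarrow> (complex ^ 'd \<Rightarrow> complex) \<Rightarrow> (complex ^ 'd \<Rightarrow> complex) \<Rightarrow> bool" where
  "boundary_function a f fs \<longleftrightarrow>
     fs \<in> borel_measurable (restrict_space borel (sphere 0 1)) \<and>
     (\<forall>\<epsilon>>0. ((\<lambda>r. outer_cap a {\<zeta> \<in> sphere 0 1. cmod (fs \<zeta> - f (r *\<^sub>R \<zeta>)) \<ge> \<epsilon>})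
              \<longlongrightarrow> 0) (at_left (1::real)))"

end

theory Submission
  imports Defs
begin

text \<open>
  Let \<open>\<mu>\<close> be a probability measure on the sphere with finite energy. Integration of \<open>g(r \<cdot>)\<close> against
  \<open>\<mu>\<close> is represented by a vector of norm at most \<open>sqrt (energy \<mu>)\<close>. If \<open>Re K \<ge> 0\<close>, the normalised
  restriction of \<open>\<mu>\<close> to \<open>A\<close> has energy at most \<open>energy \<mu> / \<mu>(A)\<^sup>2\<close>. Together these give the weak-type
  bound \<open>M \<mu>{\<bar>g(r \<cdot>)\<bar> \<ge> M} \<le> 8 \<parallel>g\<parallel> sqrt (energy \<mu>)\<close>, uniformly in \<open>r\<close>, and the domination
  \<open>\<mu>(E)\<^sup>2 \<le> energy \<mu> * outer_cap E\<close>. If \<open>\<mu>\<close> lived on the zero set of \<open>fs\<close>, then \<open>f(r \<cdot>) \<rightarrow> 0\<close> in \<open>\<mu>\<close>-measure,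
  hence \<open>\<phi> f(r \<cdot>) \<rightarrow> 0\<close> in measure for every multiplier \<open>\<phi>\<close>, since \<open>\<phi> = \<phi> 1\<close> lies in \<open>H\<close> and so is
  controlled by the weak-type bound; this contradicts \<open>\<phi> f\<close> being close to \<open>1\<close> in \<open>H\<close>.
\<close>

section \<open>Reproducing kernel Hilbert spaces\<close>

text \<open>For \<open>c > 0\<close> the minimum is at \<open>t = - b / c\<close>. Besides
  Cauchy-Schwarz this serves with \<open>a = 0\<close>, where it forces \<open>b = 0\<close>: the
  first-order condition at a minimiser.\<close>

lemma quadratic_nonneg_imp_discriminant:
  fixes a b c :: real
  assumes "0 \<le> c" and "\<And>t. 0 \<le> a + 2 * t * b + t\<^sup>2 * c"
  shows "b\<^sup>2 \<le> a * c"
proof (cases "c = 0")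
  case True
  have "b = 0"
  proof (rule ccontr)
    assume "b \<noteq> 0"
    \<comment> \<open>With \<open>c = 0\<close> the expression is affine in \<open>t\<close>, and at
      the chosen \<open>t\<close> it equals -1.\<close>
    then show False
      using assms(2)[of "- (a + 1) / (2 * b)"] True by (simp add: field_simps)
  qed
  then show ?thesis using True by simp
next
  case False
  then show ?thesis
    using assms(1) assms(2)[of "- b / c"] by (simp add: field_simps power2_eq_square)
qed

context rkhs
begin

lemma diff_closed: "\<lbrakk>f \<in> H; g \<in> H\<rbrakk> \<Longrightarrow> (\<lambda>x. f x - g x) \<in> H"
  using add_closed[of f "\<lambda>x. -1 * g x"] scale_closed[of g "-1"] by simp

lemma ip_norm_nonneg: "f \<in> H \<Longrightarrow> 0 \<le> ip_norm ip f"
  using ip_nonneg by (simp add: ip_norm_def)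

lemma ip_norm_square: "f \<in> H \<Longrightarrow> (ip_norm ip f)\<^sup>2 = Re (ip f f)"
  using ip_nonneg by (simp add: ip_norm_def)

text \<open>Hermitian symmetry gives the two cross terms the same real part. The expansion feeds
  Cauchy-Schwarz, the minimisation behind Riesz and, with \<open>t = -1\<close>, distances between
  kernel functions.\<close>

lemma Re_ip_add_scale:
  assumes "f \<in> H" "g \<in> H"
  shows "Re (ip (\<lambda>x. f x + of_real t * g x) (\<lambda>x. f x + of_real t * g x))
           = Re (ip f f) + 2 * t * Re (ip f g) + t\<^sup>2 * Re (ip g g)"
proof -
  let ?s = "\<lambda>x. of_real t * g x" and ?u = "\<lambda>x. f x + of_real t * g x"
  have s: "?s \<in> H" and u: "?u \<in> H"
    using assms by (auto intro!: scale_closed add_closed)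
  have "ip ?u ?u = ip f ?u + ip ?s ?u"
    using ip_add assms s u by blast
  moreover have "Re (ip f ?u) = Re (ip f f) + t * Re (ip f g)"
  proof -
    have "ip ?u f = ip f f + of_real t * ip g f"
      using ip_add[of f ?s f] ip_scale[of g f] assms s by simp
    then show ?thesis
      using ip_cnj[of ?u f] ip_cnj[of g f] u assms by simp
  qed
  moreover have "Re (ip ?s ?u) = t * Re (ip f g) + t\<^sup>2 * Re (ip g g)"
  proof -
    have "ip ?s ?u = of_real t * ip g ?u"
      using ip_scale assms u by blast
    moreover have "ip ?u g = ip f g + of_real t * ip g g"
      using ip_add[of f ?s g] ip_scale[of g g] assms s by simp
    ultimately show ?thesis
      using ip_cnj[of ?u g] u assms by (simp add: algebra_simps power2_eq_square)
  qed
  ultimately show ?thesis by simp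
qed

lemma Re_ip_le:
  assumes "f \<in> H" "g \<in> H"
  shows "\<bar>Re (ip f g)\<bar> \<le> ip_norm ip f * ip_norm ip g"
proof -
  let ?a = "Re (ip f f)" and ?b = "Re (ip f g)" and ?c = "Re (ip g g)"
  have q: "0 \<le> ?a + 2 * t * ?b + t\<^sup>2 * ?c" for t
    using ip_nonneg[of "\<lambda>x. f x + of_real t * g x"] Re_ip_add_scale[OF assms, of t] assms
    by (simp add: scale_closed add_closed)
  with ip_nonneg[OF assms(2)] have "?b\<^sup>2 \<le> ?a * ?c"
    by (rule quadratic_nonneg_imp_discriminant)
  also have "\<dots> = (ip_norm ip f * ip_norm ip g)\<^sup>2"
    using assms by (simp add: power_mult_distrib ip_norm_square)
  finally show ?thesis
    using assms by (simp add: abs_le_square_iff[symmetric] ip_norm_nonneg)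
qed

lemma ip_norm_scale: "f \<in> H \<Longrightarrow> ip_norm ip (\<lambda>x. c * f x) = cmod c * ip_norm ip f"
proof -
  assume f: "f \<in> H"
  let ?f = "\<lambda>x. c * f x"
  have f': "?f \<in> H" using f by (rule scale_closed)
  have "ip ?f ?f = c * cnj c * ip f f"
    using ip_scale[of f ?f c] ip_scale[of f f c] ip_cnj[of ?f f] ip_cnj[of f f] f f' by simp
  then have "Re (ip ?f ?f) = (cmod c)\<^sup>2 * Re (ip f f)"
    by (simp add: complex_norm_square[symmetric])
  then show ?thesis by (simp add: ip_norm_def real_sqrt_mult)
qed

lemma cmod_ip_le:
  assumes "f \<in> H" "g \<in> H"
  shows "cmod (ip f g) \<le> ip_norm ip f * ip_norm ip g"
proof (cases "ip f g = 0")
  case True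
  then show ?thesis using assms by (simp add: ip_norm_nonneg)
next
  case False
  \<comment> \<open>This unimodular factor rotates \<open>ip f g\<close> onto the positive real
    axis, where the bound for real parts applies.\<close>
  define c where "c = cnj (ip f g) / cmod (ip f g)"
  have c: "cmod c = 1" using False by (simp add: c_def norm_divide)
  let ?f = "\<lambda>x. c * f x"
  have f: "?f \<in> H" using assms by (simp add: scale_closed)
  have "c * ip f g = of_real (cmod (ip f g))"
    using False complex_norm_square[of "ip f g"]
    by (simp add: c_def power2_eq_square field_simps)
  then have "ip ?f g = of_real (cmod (ip f g))"
    using ip_scale[OF assms, of c] by simp
  then have "cmod (ip f g) \<le> ip_norm ip ?f * ip_norm ip g"
    using Re_ip_le[OF f assms(2)] by simp
  also have "ip_norm ip ?f = ip_norm ip f"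
    using c assms by (simp add: ip_norm_scale)
  finally show ?thesis .
qed

text \<open>The representing vector minimises \<open>\<parallel>u\<parallel>\<^sup>2 - 2 Re (\<Lambda> u)\<close>; by the parallelogram law every
  minimising sequence is Cauchy.\<close>

lemma riesz_representation:
  assumes add: "\<And>f g. \<lbrakk>f \<in> H; g \<in> H\<rbrakk> \<Longrightarrow> \<Lambda> (\<lambda>x. f x + g x) = \<Lambda> f + \<Lambda> g"
    and scale: "\<And>c f. f \<in> H \<Longrightarrow> \<Lambda> (\<lambda>x. c * f x) = c * \<Lambda> f"
    and bound: "\<And>f. f \<in> H \<Longrightarrow> cmod (\<Lambda> f) \<le> B * ip_norm ip f"
  shows "\<exists>v\<in>H. \<forall>g\<in>H. \<Lambda> g = ip g v"
proof -
  \<comment> \<open>If \<open>v\<close> represents \<Lambda>, then \<open>J u\<close> is the squared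
    distance from \<open>u\<close> to \<open>v\<close> minus the squared norm of \<open>v\<close>,
    so a minimiser is the vector sought.\<close>
  define J where "J u = Re (ip u u) - 2 * Re (\<Lambda> u)" for u
  have J_add: "J (\<lambda>x. f x + of_real t * g x)
      = J f + 2 * t * (Re (ip f g) - Re (\<Lambda> g)) + t\<^sup>2 * Re (ip g g)"
    if "f \<in> H" "g \<in> H" for f g t
    using that add[of f "\<lambda>x. of_real t * g x"] scale[of g "of_real t"] scale_closed[of g "of_real t"]
    by (simp add: J_def Re_ip_add_scale algebra_simps)
  have J_lower: "- (B\<^sup>2) \<le> J u" if "u \<in> H" for u
  proof -
    have "Re (\<Lambda> u) \<le> B * ip_norm ip u"
      using bound[OF that] complex_Re_le_cmod[of "\<Lambda> u"] by linarith
    then have "J u \<ge> (ip_norm ip u)\<^sup>2 - 2 * (B * ip_norm ip u)"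
      using that by (simp add: J_def ip_norm_square)
    moreover have "0 \<le> (ip_norm ip u - B)\<^sup>2" by simp
    ultimately show ?thesis by (simp add: power2_eq_square algebra_simps)
  qed
  define m where "m = (INF u\<in>H. J u)"
  have bdd: "bdd_below (J ` H)" using J_lower by (auto intro!: bdd_belowI)
  have m_le: "m \<le> J u" if "u \<in> H" for u
    unfolding m_def using bdd that by (rule cINF_lower)
  have "\<exists>u\<in>H. J u < m + 1 / Suc n" for n
  proof -
    have "(INF u\<in>H. J u) < m + 1 / Suc n" by (simp add: m_def)
    then show ?thesis using cINF_less_iff[OF _ bdd] zero_closed by blast
  qed
  then obtain s where s: "\<And>n. s n \<in> H" "\<And>n. J (s n) < m + 1 / Suc n" by metis
  have par: "(ip_norm ip (\<lambda>x. s k x - s n x))\<^sup>2 < 2 / Suc k + 2 / Suc n" for k n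
  proof -
    let ?d = "\<lambda>x. s k x - s n x"
    have d: "?d \<in> H" using s diff_closed by blast
    have 1: "J (s k) = J (s n) + 2 * (Re (ip (s n) ?d) - Re (\<Lambda> ?d)) + Re (ip ?d ?d)"
      using J_add[OF s(1) d, of n 1] by simp
    \<comment> \<open>This is the midpoint of \<open>s k\<close> and \<open>s n\<close>. As
      \<open>J\<close> is at least \<open>m\<close> there, the squared norm of \<open>?d\<close> is
      at most twice the sum of the excesses of \<open>J (s k)\<close> and \<open>J (s n)\<close>
      over \<open>m\<close>.\<close>
    have "(\<lambda>x. s n x + of_real (1/2) * ?d x) \<in> H"
      using s d add_closed scale_closed by blast
    from m_le[OF this]
    have "m \<le> J (s n) + (Re (ip (s n) ?d) - Re (\<Lambda> ?d)) + (1/4) * Re (ip ?d ?d)"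
      using J_add[OF s(1) d, of n "1/2"] by (simp add: power2_eq_square)
    with 1 s(2)[of k] s(2)[of n] show ?thesis
      using ip_norm_square[OF d] by simp
  qed
  have "\<exists>v\<in>H. (\<lambda>n. ip_norm ip (\<lambda>x. s n x - v x)) \<longlonglongrightarrow> 0"
  proof (rule complete)
    show "\<forall>\<epsilon>>0. \<exists>N. \<forall>k\<ge>N. \<forall>n\<ge>N. ip_norm ip (\<lambda>x. s k x - s n x) < \<epsilon>"
    proof (intro allI impI)
      fix \<epsilon> :: real assume "\<epsilon> > 0"
      then obtain N where N: "1 / real (Suc N) < \<epsilon>\<^sup>2 / 4"
        using reals_Archimedean[of "\<epsilon>\<^sup>2 / 4"] by (auto simp: inverse_eq_divide)
      have "ip_norm ip (\<lambda>x. s k x - s n x) < \<epsilon>" if "k \<ge> N" "n \<ge> N" for k n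
      proof -
        have "1 / real (Suc j) \<le> 1 / real (Suc N)" if "j \<ge> N" for j
          using that by (intro divide_left_mono) auto
        from this[OF that(1)] this[OF that(2)]
        have "(ip_norm ip (\<lambda>x. s k x - s n x))\<^sup>2 < \<epsilon>\<^sup>2"
          using par[of k n] N by simp
        then show ?thesis using \<open>\<epsilon> > 0\<close> power_less_imp_less_base by fastforce
      qed
      then show "\<exists>N. \<forall>k\<ge>N. \<forall>n\<ge>N. ip_norm ip (\<lambda>x. s k x - s n x) < \<epsilon>" by blast
    qed
  qed (use s in simp)
  then obtain v where v: "v \<in> H" and lim: "(\<lambda>n. ip_norm ip (\<lambda>x. s n x - v x)) \<longlonglongrightarrow> 0" by blast
  \<comment> \<open>Continuity of \<open>J\<close> at \<open>v\<close>, made quantitative: the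
    linear terms are bounded by Cauchy-Schwarz and by \<open>B\<close>, and the quadratic term is
    dropped because it is non-negative.\<close>
  have "J v \<le> m"
  proof (rule LIMSEQ_le)
    define \<epsilon> where "\<epsilon> n = ip_norm ip (\<lambda>x. s n x - v x)" for n
    show "(\<lambda>n. J v - 2 * (ip_norm ip v + B) * \<epsilon> n) \<longlonglongrightarrow> J v"
      using lim unfolding \<epsilon>_def[symmetric] by (auto intro!: tendsto_eq_intros)
    show "(\<lambda>n. m + 1 / real (Suc n)) \<longlonglongrightarrow> m"
      using LIMSEQ_inverse_real_of_nat_add[of m] by (simp add: inverse_eq_divide)
    have "J v - 2 * (ip_norm ip v + B) * \<epsilon> n \<le> m + 1 / real (Suc n)" for n
    proof -
      let ?d = "\<lambda>x. s n x - v x"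
      have d: "?d \<in> H" using s v diff_closed by blast
      have "J (s n) = J v + 2 * (Re (ip v ?d) - Re (\<Lambda> ?d)) + Re (ip ?d ?d)"
        using J_add[OF v d, of 1] by simp
      moreover have "- Re (ip v ?d) \<le> ip_norm ip v * \<epsilon> n"
        using Re_ip_le[OF v d] by (simp add: \<epsilon>_def)
      moreover have "Re (\<Lambda> ?d) \<le> B * \<epsilon> n"
        using bound[OF d] complex_Re_le_cmod[of "\<Lambda> ?d"] by (simp add: \<epsilon>_def)
      ultimately show ?thesis
        using s(2)[of n] ip_nonneg[OF d] by (simp add: algebra_simps)
    qed
    then show "\<exists>N. \<forall>n\<ge>N. J v - 2 * (ip_norm ip v + B) * \<epsilon> n \<le> m + 1 / real (Suc n)" by blast
  qed
  have Re_eq: "Re (\<Lambda> g) = Re (ip g v)" if g: "g \<in> H" for g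
  proof -
    \<comment> \<open>Here \<open>2 * ?b\<close> is the derivative of \<open>J\<close> at
      \<open>v\<close> in the direction \<open>g\<close>; minimality makes it vanish.\<close>
    let ?b = "Re (ip v g) - Re (\<Lambda> g)" and ?c = "Re (ip g g)"
    have q: "0 \<le> 2 * t * ?b + t\<^sup>2 * ?c" for t
    proof -
      have "(\<lambda>x. v x + of_real t * g x) \<in> H"
        using v g add_closed scale_closed by blast
      from m_le[OF this] show ?thesis
        using J_add[OF v g, of t] \<open>J v \<le> m\<close> by simp
    qed
    have "?b\<^sup>2 \<le> 0 * ?c"
      using q ip_nonneg[OF g] by (intro quadratic_nonneg_imp_discriminant) simp_all
    then show ?thesis using ip_cnj[OF v g] by simp
  qed
  have "\<Lambda> g = ip g v" if g: "g \<in> H" for g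
  proof -
    \<comment> \<open>Multiplying by \<open>\<i>\<close> turns real parts into negated imaginary
      parts, so the real identity yields the complex one.\<close>
    have "Re (\<Lambda> (\<lambda>x. \<i> * g x)) = Re (ip (\<lambda>x. \<i> * g x) v)"
      using Re_eq g scale_closed by blast
    then show ?thesis
      using Re_eq[OF g] scale[OF g] ip_scale[OF g v] by (simp add: complex_eq_iff)
  qed
  then show ?thesis using v by (intro bexI[of _ v] ballI)
qed

section \<open>Estimates from the reproducing property\<close>

lemma kernel_hermitian: "\<lbrakk>z \<in> X; w \<in> X\<rbrakk> \<Longrightarrow> K w z = cnj (K z w)"
  using reproducing[OF kernel_mem[of z], of w] reproducing[OF kernel_mem[of w], of z]
    ip_cnj[OF kernel_mem[of w] kernel_mem[of z]]
  by (simp add: on_set_def)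

lemma cmod_le_kernel:
  assumes "f \<in> H" "w \<in> X"
  shows "cmod (f w) \<le> ip_norm ip f * sqrt (Re (K w w))"
  using cmod_ip_le[OF assms(1) kernel_mem[OF assms(2)]] reproducing[OF assms]
    reproducing[OF kernel_mem[OF assms(2)] assms(2)] assms(2)
  by (simp add: ip_norm_def on_set_def)

text \<open>The difference is the inner product of \<open>f\<close> with the difference of two
  kernel functions, and the square root is the norm of that difference. Continuity of the kernel
  thus passes to every member of \<open>H\<close>.\<close>

lemma cmod_diff_le_kernel:
  assumes "f \<in> H" "z \<in> X" "w \<in> X"
  shows "cmod (f z - f w) \<le> ip_norm ip f * sqrt (Re (K z z) - 2 * Re (K z w) + Re (K w w))"
proof -
  let ?k = "\<lambda>w. on_set X (\<lambda>z. K z w)"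
  let ?d = "\<lambda>x. ?k z x + of_real (-1) * ?k w x"
  have k: "?k z \<in> H" "?k w \<in> H" using kernel_mem assms by blast+
  have d: "?d \<in> H" using k add_closed scale_closed by blast
  have "ip ?d f = ip (?k z) f + of_real (-1) * ip (?k w) f"
    by (simp only: ip_add[OF k(1) scale_closed[OF k(2)] assms(1)] ip_scale[OF k(2) assms(1)])
  then have "ip f ?d = f z - f w"
    using ip_cnj[OF d assms(1)] ip_cnj[OF k(1) assms(1)] ip_cnj[OF k(2) assms(1)]
      reproducing assms by simp
  moreover have "Re (ip ?d ?d) = Re (K z z) - 2 * Re (K z w) + Re (K w w)"
    using Re_ip_add_scale[OF k, of "-1"] reproducing[OF k(1)] reproducing[OF k(2)] assms
      kernel_hermitian[of z w]
    by (simp add: on_set_def)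
  ultimately show ?thesis
    using cmod_ip_le[OF assms(1) d] by (simp add: ip_norm_def)
qed

text \<open>The left-hand side is the inner product of \<open>g\<close> with \<open>\<integral> K(\<cdot>, p y) d\<nu>(y)\<close>, whose squared norm
  is the double integral.\<close>

lemma integral_le_double_integral_kernel:
  assumes "finite_measure \<nu>"
    and p: "\<And>y. y \<in> space \<nu> \<Longrightarrow> p y \<in> X"
    and meas: "\<And>g. g \<in> H \<Longrightarrow> (\<lambda>y. g (p y)) \<in> borel_measurable \<nu>"
    and bounded: "\<And>y. y \<in> space \<nu> \<Longrightarrow> Re (K (p y) (p y)) \<le> B"
    and g: "g \<in> H"
  shows "cmod (\<integral>y. g (p y) \<partial>\<nu>) \<le> ip_norm ip g * sqrt (Re (\<integral>y. (\<integral>y'. K (p y) (p y') \<partial>\<nu>) \<partial>\<nu>))"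
proof -
  interpret finite_measure \<nu> by fact
  have point: "cmod (g (p y)) \<le> ip_norm ip g * sqrt B" if "g \<in> H" "y \<in> space \<nu>" for g y
    using cmod_le_kernel[OF that(1) p[OF that(2)]] bounded[OF that(2)] ip_norm_nonneg[OF that(1)]
    by (meson mult_left_mono order_trans real_sqrt_le_mono)
  have int: "integrable \<nu> (\<lambda>y. g (p y))" if "g \<in> H" for g
    using that point by (intro integrable_const_bound[where B = "ip_norm ip g * sqrt B"] meas) auto
  define \<Lambda> :: "('x \<Rightarrow> complex) \<Rightarrow> complex" where "\<Lambda> g = (\<integral>y. g (p y) \<partial>\<nu>)" for g
  \<comment> \<open>This crude bound only makes Riesz representation applicable; the final estimate
    uses the norm of the representing vector and is free of \<open>B\<close>.\<close>
  have bound: "cmod (\<Lambda> g) \<le> (sqrt B * measure \<nu> (space \<nu>)) * ip_norm ip g" if "g \<in> H" for g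
  proof -
    have "cmod (\<Lambda> g) \<le> (\<integral>y. cmod (g (p y)) \<partial>\<nu>)"
      unfolding \<Lambda>_def by (rule integral_norm_bound)
    also have "\<dots> \<le> (\<integral>y. ip_norm ip g * sqrt B \<partial>\<nu>)"
      using point[OF that] int[OF that] by (intro integral_mono) auto
    finally show ?thesis by (simp add: mult_ac)
  qed
  have "\<exists>v\<in>H. \<forall>g\<in>H. \<Lambda> g = ip g v"
  proof (rule riesz_representation)
    show "\<Lambda> (\<lambda>x. f x + g x) = \<Lambda> f + \<Lambda> g" if "f \<in> H" "g \<in> H" for f g
      unfolding \<Lambda>_def using int that by (intro Bochner_Integration.integral_add)
    show "\<Lambda> (\<lambda>x. c * f x) = c * \<Lambda> f" for c f
      unfolding \<Lambda>_def by (rule integral_mult_right_zero)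
  qed (rule bound)
  then obtain v where v: "v \<in> H" and rep: "\<forall>g\<in>H. \<Lambda> g = ip g v" ..
  \<comment> \<open>Testing against the kernel function at \<open>w\<close> identifies the abstract
    vector as the kernel average, which replaces a vector-valued integral.\<close>
  have v_eq: "v w = (\<integral>y. K w (p y) \<partial>\<nu>)" if "w \<in> X" for w
  proof -
    have "v w = ip v (on_set X (\<lambda>z. K z w))" using reproducing[OF v that] ..
    also have "\<dots> = cnj (ip (on_set X (\<lambda>z. K z w)) v)" by (rule ip_cnj[OF kernel_mem[OF that] v])
    also have "\<dots> = cnj (\<Lambda> (on_set X (\<lambda>z. K z w)))" using rep kernel_mem[OF that] by metis
    also have "\<dots> = (\<integral>y. cnj (on_set X (\<lambda>z. K z w) (p y)) \<partial>\<nu>)"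
      unfolding \<Lambda>_def by simp
    also have "\<dots> = (\<integral>y. K w (p y) \<partial>\<nu>)"
    proof (intro Bochner_Integration.integral_cong refl)
      fix y assume "y \<in> space \<nu>"
      then show "cnj (on_set X (\<lambda>z. K z w) (p y)) = K w (p y)"
        using kernel_hermitian[OF p that, of y] p by (simp add: on_set_def)
    qed
    finally show ?thesis .
  qed
  have "ip v v = (\<integral>y. v (p y) \<partial>\<nu>)"
    using rep v by (metis \<Lambda>_def)
  also have "\<dots> = (\<integral>y. (\<integral>y'. K (p y) (p y') \<partial>\<nu>) \<partial>\<nu>)"
    by (intro Bochner_Integration.integral_cong refl v_eq p)
  finally have "ip_norm ip v = sqrt (Re (\<integral>y. (\<integral>y'. K (p y) (p y') \<partial>\<nu>) \<partial>\<nu>))"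
    by (simp only: ip_norm_def)
  then show ?thesis
    using cmod_ip_le[OF g v] bspec[OF rep g] by (simp only: \<Lambda>_def)
qed

end

section \<open>The kernel and the dilations\<close>

lemma cmod_herm_le: "cmod (herm z w) \<le> norm z * norm w"
proof -
  have "cmod (herm z w) \<le> (\<Sum>i\<in>UNIV. \<bar>cmod (z $ i)\<bar> * \<bar>cmod (w $ i)\<bar>)"
    unfolding herm_def by (rule order_trans[OF norm_sum]) (simp add: norm_mult)
  also have "\<dots> \<le> norm z * norm w"
    using L2_set_mult_ineq[of "\<lambda>i. cmod (z $ i)" "\<lambda>i. cmod (w $ i)" UNIV]
    by (simp add: norm_vec_def)
  finally show ?thesis .
qed

lemma continuous_on_herm: "continuous_on S (\<lambda>p. herm (fst p) (snd p))"
  unfolding herm_def by (intro continuous_intros)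

text \<open>Measurability holds on all pairs, also where the series diverges, because
  \<open>suminf\<close> preserves it. It is used for joint measurability in double
  integrals.\<close>

lemma borel_measurable_ui_kernel:
  "(\<lambda>p. ui_kernel a (fst p) (snd p)) \<in> borel_measurable borel"
proof -
  have [measurable]: "(\<lambda>p::(complex ^ 'd) \<times> _. herm (fst p) (snd p)) \<in> borel_measurable borel"
    using continuous_on_herm by (rule borel_measurable_continuous_onI)
  show ?thesis unfolding ui_kernel_def by measurable
qed

lemma scaleR_sphere_in_ball:
  fixes z :: "'a :: real_normed_vector"
  assumes "0 \<le> r" "r < 1" "z \<in> sphere 0 1"
  shows "r *\<^sub>R z \<in> ball 0 1"
  using assms by simp

context regular_unitarily_invariant_space
begin

text \<open>The ratio test turns regularity of the coefficients into convergence on the open unit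
  disc, the range of \<open>herm\<close> on pairs of points of the ball.\<close>

lemma conv_radius_coeff: "conv_radius (\<lambda>n. complex_of_real (a n)) = 1"
proof (rule conv_radius_ratio_limit_nonzero[where c = 1])
  show "(\<lambda>n. norm (complex_of_real (a n)) / norm (complex_of_real (a (Suc n)))) \<longlonglongrightarrow> 1"
    using coeff_regular coeff_pos by (simp add: less_imp_le)
qed (simp_all add: one_ereal_def)

lemma continuous_on_ui_kernel:
  "continuous_on (ball 0 1 \<times> ball 0 1) (\<lambda>p. ui_kernel a (fst p) (snd p :: complex ^ 'd))"
proof -
  have "isCont (\<lambda>t. \<Sum>n. complex_of_real (a n) * t ^ n) t" if t: "cmod t < 1" for t
  proof -
    \<comment> \<open>A real point strictly between \<open>cmod t\<close> and 1: convergence there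
      gives continuity at \<open>t\<close>.\<close>
    obtain s where s: "cmod t < s" "s < 1" using dense[OF t] by blast
    then have s': "norm (complex_of_real s) = s"
      using norm_ge_zero[of t] by (simp only: norm_of_real)
    show ?thesis
    proof (rule isCont_powser[where K = "complex_of_real s"])
      show "summable (\<lambda>n. complex_of_real (a n) * complex_of_real s ^ n)"
        using s s' by (intro summable_in_conv_radius) (simp add: conv_radius_coeff one_ereal_def)
    qed (use s s' in simp)
  qed
  then have "continuous_on (ball 0 1) (\<lambda>t. \<Sum>n. complex_of_real (a n) * t ^ n)"
    by (intro continuous_at_imp_continuous_on) simp
  moreover have "herm (fst p) (snd p) \<in> ball 0 1"
    if "p \<in> ball 0 1 \<times> ball 0 (1 :: real)" for p :: "(complex ^ 'd) \<times> (complex ^ 'd)"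
  proof -
    have "norm (fst p) < 1" "norm (snd p) < 1" using that by (auto simp: mem_Times_iff)
    then have "norm (fst p) * norm (snd p) < 1"
      using mult_strict_mono[of "norm (fst p)" 1 "norm (snd p)" 1] by simp
    then show ?thesis using cmod_herm_le[of "fst p" "snd p"] by simp
  qed
  ultimately show ?thesis
    unfolding ui_kernel_def by (intro continuous_on_compose2[OF _ continuous_on_herm]) auto
qed

text \<open>The norm distance between the kernel functions at \<open>z\<close> and \<open>w\<close>
  tends to 0 as \<open>w\<close> tends to \<open>z\<close>, and it controls the increments of
  \<open>f\<close>.\<close>

lemma continuous_on_member:
  assumes f: "f \<in> H"
  shows "continuous_on (ball 0 1) f"
  unfolding continuous_on_def
proof
  fix z :: "complex ^ 'd" assume z: "z \<in> ball 0 1"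
  let ?F = "at z within ball 0 1"
  have "(ui_kernel a z \<longlongrightarrow> ui_kernel a z z) ?F" and "((\<lambda>w. ui_kernel a w w) \<longlongrightarrow> ui_kernel a z z) ?F"
  proof -
    have "continuous_on (ball 0 1) (\<lambda>w. (z, w))" by (intro continuous_intros)
    from continuous_on_compose2[OF continuous_on_ui_kernel this]
    have 1: "continuous_on (ball 0 1) (\<lambda>w. ui_kernel a z w)"
      using z by (auto simp: image_subset_iff)
    have "continuous_on (ball 0 1) (\<lambda>w :: complex ^ 'd. (w, w))" by (intro continuous_intros)
    from continuous_on_compose2[OF continuous_on_ui_kernel this]
    have 2: "continuous_on (ball 0 1) (\<lambda>w :: complex ^ 'd. ui_kernel a w w)"
      by auto
    show "(ui_kernel a z \<longlongrightarrow> ui_kernel a z z) ?F" "((\<lambda>w. ui_kernel a w w) \<longlongrightarrow> ui_kernel a z z) ?F"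
      using 1 2 z unfolding continuous_on_def by blast+
  qed
  then have "((\<lambda>w. ip_norm ip f * sqrt (Re (ui_kernel a z z) - 2 * Re (ui_kernel a z w)
      + Re (ui_kernel a w w))) \<longlongrightarrow> ip_norm ip f * sqrt (Re (ui_kernel a z z)
      - 2 * Re (ui_kernel a z z) + Re (ui_kernel a z z))) ?F"
    by (intro tendsto_intros)
  then have lim: "((\<lambda>w. ip_norm ip f * sqrt (Re (ui_kernel a z z) - 2 * Re (ui_kernel a z w)
      + Re (ui_kernel a w w))) \<longlongrightarrow> 0) ?F"
    by simp
  have "((\<lambda>w. f w - f z) \<longlongrightarrow> 0) ?F"
  proof (rule Lim_null_comparison[OF _ lim])
    show "\<forall>\<^sub>F w in ?F. norm (f w - f z) \<le> ip_norm ip f * sqrt (Re (ui_kernel a z z)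
        - 2 * Re (ui_kernel a z w) + Re (ui_kernel a w w))"
      unfolding eventually_at_filter
    proof (intro always_eventually allI impI)
      fix w :: "complex ^ 'd" assume "w \<in> ball 0 1"
      then show "norm (f w - f z) \<le> ip_norm ip f * sqrt (Re (ui_kernel a z z)
          - 2 * Re (ui_kernel a z w) + Re (ui_kernel a w w))"
        using cmod_diff_le_kernel[OF f z, of w] by (simp add: norm_minus_commute)
    qed
  qed
  then show "(f \<longlongrightarrow> f z) ?F" by (rule LIM_zero_cancel)
qed

lemma borel_measurable_dilation:
  assumes "f \<in> H" "0 \<le> r" "r < 1"
  shows "(\<lambda>\<zeta>. f (r *\<^sub>R \<zeta>)) \<in> borel_measurable (restrict_space borel (sphere 0 1))"
  using assms scaleR_sphere_in_ball[OF assms(2,3)]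
  by (intro borel_measurable_continuous_on_restrict
      continuous_on_compose2[OF continuous_on_member[OF assms(1)]])
     (auto intro!: continuous_intros)

text \<open>Compactness of the product of two spheres. The bound depends on \<open>r\<close> and
  serves only integrability; estimates uniform in \<open>r\<close> come from the energy.\<close>

lemma ui_kernel_dilation_bounded:
  assumes "0 \<le> r" "r < 1"
  obtains B where "\<And>z w :: complex ^ 'd. \<lbrakk>z \<in> sphere 0 1; w \<in> sphere 0 1\<rbrakk> \<Longrightarrow>
    cmod (ui_kernel a (r *\<^sub>R z) (r *\<^sub>R w)) \<le> B"
proof -
  let ?S = "sphere 0 1 :: (complex ^ 'd) set"
  let ?k = "\<lambda>p. ui_kernel a (r *\<^sub>R fst p) (r *\<^sub>R snd p :: complex ^ 'd)"
  have "continuous_on (?S \<times> ?S) ?k"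
    using scaleR_sphere_in_ball[OF assms]
      continuous_on_compose2[OF continuous_on_ui_kernel, of "?S \<times> ?S" "\<lambda>p. (r *\<^sub>R fst p, r *\<^sub>R snd p)"]
    by (force intro!: continuous_intros)
  moreover have "compact (?S \<times> ?S)" by (intro compact_Times compact_sphere)
  ultimately have "bounded (?k ` (?S \<times> ?S))"
    by (intro compact_imp_bounded compact_continuous_image)
  then obtain B where B: "\<forall>x \<in> ?k ` (?S \<times> ?S). cmod x \<le> B"
    by (auto simp only: bounded_iff)
  then have "cmod (ui_kernel a (r *\<^sub>R z) (r *\<^sub>R w)) \<le> B" if "z \<in> ?S" "w \<in> ?S" for z w
  proof -
    have "(z, w) \<in> ?S \<times> ?S" using that by simp
    from B[rule_format, OF imageI[OF this]] show ?thesis by simp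
  qed
  then show thesis using that by blast
qed

lemma ui_kernel_zero: "ui_kernel a z 0 = 1"
proof -
  have "ui_kernel a z 0 = (\<Sum>n. complex_of_real (a n) * 0 ^ n)"
    by (simp add: ui_kernel_def herm_def)
  also have "\<dots> = 1" using coeff_0 by (subst powser_zero) simp
  finally show ?thesis .
qed

text \<open>The constant is the kernel function at the origin. Multipliers applied to it land in
  \<open>H\<close>, and it is the function that cyclicity will approximate.\<close>

lemma one_mem: "on_set (ball 0 1) (\<lambda>z. 1) \<in> H"
  using kernel_mem[of 0] by (simp add: ui_kernel_zero)

lemma Mult_subset: "\<phi> \<in> Mult (ball 0 1) H \<Longrightarrow> \<phi> \<in> H"
proof -
  assume \<phi>: "\<phi> \<in> Mult (ball 0 1) H"
  then have "(\<lambda>x. \<phi> x * on_set (ball 0 1) (\<lambda>z. 1) x) \<in> H"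
    using one_mem by (simp add: Mult_def)
  also have "(\<lambda>x. \<phi> x * on_set (ball 0 1) (\<lambda>z. 1) x) = \<phi>"
    using \<phi> by (auto simp: Mult_def on_set_def fun_eq_iff)
  finally show ?thesis .
qed

end

section \<open>Energy and capacity\<close>

text \<open>Since \<open>Re k\<close> is non-negative, restricting first the inner and then the
  outer integral to \<open>A\<close> can only decrease the real part; each normalisation contributes
  a factor \<open>1 / measure M A\<close>.\<close>

lemma double_integral_uniform_measure_le:
  fixes k :: "'a \<Rightarrow> 'a \<Rightarrow> complex"
  assumes "finite_measure M" and A: "A \<in> sets M" and pos: "0 < measure M A"
    and k[measurable]: "(\<lambda>p. k (fst p) (snd p)) \<in> borel_measurable (M \<Otimes>\<^sub>M M)"
    and bounded: "\<And>x y. \<lbrakk>x \<in> space M; y \<in> space M\<rbrakk> \<Longrightarrow> cmod (k x y) \<le> B"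
    and nonneg: "\<And>x y. \<lbrakk>x \<in> space M; y \<in> space M\<rbrakk> \<Longrightarrow> 0 \<le> Re (k x y)"
  shows "Re (\<integral>x. (\<integral>y. k x y \<partial>uniform_measure M A) \<partial>uniform_measure M A)
           \<le> Re (\<integral>x. (\<integral>y. k x y \<partial>M) \<partial>M) / (measure M A)\<^sup>2"
proof -
  interpret finite_measure M by fact
  note A[measurable]
  define m where "m = measure M A"
  have m: "0 < m" using pos by (simp add: m_def)
  have uniform: "uniform_measure M A = density M (\<lambda>x. ennreal (indicator A x / m))"
  proof -
    have "indicator A x / ennreal m = ennreal (indicator A x / m)" for x
      using m divide_ennreal[of 1 m] by (simp add: indicator_def)
    then show ?thesis by (simp add: uniform_measure_def emeasure_eq_measure m_def)
  qed
  have int_uniform: "(\<integral>x. g x \<partial>uniform_measure M A) = (\<integral>x. indicator A x *\<^sub>R g x \<partial>M) /\<^sub>R m"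
    if "g \<in> borel_measurable M" for g :: "'a \<Rightarrow> complex"
  proof -
    have "(\<integral>x. g x \<partial>uniform_measure M A) = (\<integral>x. (indicator A x / m) *\<^sub>R g x \<partial>M)"
      unfolding uniform using that m by (intro integral_density) auto
    also have "\<dots> = (\<integral>x. inverse m *\<^sub>R (indicator A x *\<^sub>R g x) \<partial>M)"
      by (simp add: divide_inverse mult.commute)
    finally show ?thesis by (simp only: integral_scaleR_right)
  qed
  \<comment> \<open>The maximum with 0 lets the constant also dominate integrands cut off to 0
    outside \<open>A\<close>.\<close>
  define B' where "B' = max B 0"
  have B': "cmod (k x y) \<le> B'" if "x \<in> space M" "y \<in> space M" for x y
    using bounded[OF that] by (simp add: B'_def)
  have k_sec: "k x \<in> borel_measurable M" if "x \<in> space M" for x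
    using measurable_Pair2[OF k that] by simp
  have int_k: "integrable M (k x)" if "x \<in> space M" for x
    using B' that k_sec by (intro integrable_const_bound[where B = B']) auto
  have int_Ak: "integrable M (\<lambda>y. indicator A y *\<^sub>R k x y)" if "x \<in> space M" for x
    using int_k[OF that] A by (intro integrable_mult_indicator)
  define I where "I x = (\<integral>y. k x y \<partial>M)" for x
  define J where "J x = (\<integral>y. indicator A y *\<^sub>R k x y \<partial>M)" for x
  have [measurable]: "I \<in> borel_measurable M" "J \<in> borel_measurable M"
    unfolding I_def J_def by (auto intro!: borel_measurable_lebesgue_integral simp: case_prod_beta)
  have cmod_I: "cmod (I x) \<le> B' * measure M (space M)" if "x \<in> space M" for x
  proof -
    have "cmod (I x) \<le> (\<integral>y. cmod (k x y) \<partial>M)" unfolding I_def by (rule integral_norm_bound)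
    also have "\<dots> \<le> (\<integral>y. B' \<partial>M)" using B' that int_k by (intro integral_mono) auto
    finally show ?thesis by (simp add: mult.commute)
  qed
  \<comment> \<open>For the outer integral the second inequality is used on \<open>A\<close>; off
    \<open>A\<close> the two together give \<open>0 \<le> Re (I x)\<close>.\<close>
  have Re_J: "0 \<le> Re (J x)" "Re (J x) \<le> Re (I x)" if x: "x \<in> space M" for x
  proof -
    have J: "Re (J x) = (\<integral>y. indicator A y * Re (k x y) \<partial>M)"
      unfolding J_def using int_Ak[OF x] by (subst integral_Re[symmetric]) auto
    have I: "Re (I x) = (\<integral>y. Re (k x y) \<partial>M)"
      unfolding I_def using int_k[OF x] by (subst integral_Re[symmetric]) auto
    show "0 \<le> Re (J x)" unfolding J using nonneg x
      by (intro integral_nonneg_AE AE_I2) auto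
    show "Re (J x) \<le> Re (I x)" unfolding I J
    proof (rule integral_mono)
      show "integrable M (\<lambda>y. indicator A y * Re (k x y))"
        using integrable_Re[OF int_Ak[OF x]] by simp
    qed (use nonneg x int_k[OF x] in \<open>auto simp: indicator_def\<close>)
  qed
  have int_I: "integrable M I"
    using cmod_I by (intro integrable_const_bound[where B = "B' * measure M (space M)"]) auto
  have cmod_J: "cmod (J x) \<le> B' * measure M (space M)" if x: "x \<in> space M" for x
  proof -
    have "cmod (J x) \<le> (\<integral>y. cmod (indicator A y *\<^sub>R k x y) \<partial>M)"
      unfolding J_def by (rule integral_norm_bound)
    also have "\<dots> \<le> (\<integral>y. B' \<partial>M)"
    proof (rule integral_mono)
      show "integrable M (\<lambda>y. cmod (indicator A y *\<^sub>R k x y))"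
        using int_Ak[OF x] by (rule integrable_norm)
    qed (use B'[OF x] in \<open>auto simp: indicator_def B'_def\<close>)
    finally show ?thesis by (simp add: mult.commute)
  qed
  have int_J: "integrable M J"
    using cmod_J by (intro integrable_const_bound[where B = "B' * measure M (space M)"]) auto
  have int_AJ: "integrable M (\<lambda>x. indicator A x *\<^sub>R J x)"
    using int_J A by (intro integrable_mult_indicator)
  have "(\<integral>x. (\<integral>y. k x y \<partial>uniform_measure M A) \<partial>uniform_measure M A)
      = (\<integral>x. J x /\<^sub>R m \<partial>uniform_measure M A)"
    using int_uniform k_sec by (intro Bochner_Integration.integral_cong) (auto simp: J_def)
  also have "\<dots> = (\<integral>x. inverse m *\<^sub>R (indicator A x *\<^sub>R J x) \<partial>M) /\<^sub>R m"
    by (subst int_uniform) (simp_all add: mult.commute)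
  also have "\<dots> = inverse m *\<^sub>R (\<integral>x. indicator A x *\<^sub>R J x \<partial>M) /\<^sub>R m"
    by (simp only: integral_scaleR_right)
  finally have "Re (\<integral>x. (\<integral>y. k x y \<partial>uniform_measure M A) \<partial>uniform_measure M A)
      = Re (\<integral>x. indicator A x *\<^sub>R J x \<partial>M) / m\<^sup>2"
    by (simp add: power2_eq_square divide_inverse mult_ac)
  also have "Re (\<integral>x. indicator A x *\<^sub>R J x \<partial>M) \<le> Re (\<integral>x. I x \<partial>M)"
  proof -
    have "(\<integral>x. indicator A x * Re (J x) \<partial>M) \<le> (\<integral>x. Re (I x) \<partial>M)"
    proof (rule integral_mono)
      show "integrable M (\<lambda>x. indicator A x * Re (J x))"
        using integrable_Re[OF int_AJ] by simp
      show "integrable M (\<lambda>x. Re (I x))" using int_I by (rule integrable_Re)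
      show "indicator A x * Re (J x) \<le> Re (I x)" if "x \<in> space M" for x
        using Re_J[OF that] by (auto simp: indicator_def)
    qed
    then show ?thesis
      using integral_Re[OF int_AJ] integral_Re[OF int_I] by simp
  qed
  finally show ?thesis
    using m by (simp add: I_def m_def divide_right_mono)
qed

text \<open>Inner regularity concerns Borel measures on the whole Polish space, so \<open>M\<close>
  is pushed forward along the inclusion of \<open>S\<close>. Its measurable sets are the Borel
  subsets of \<open>S\<close>, so the compact set found is measurable for \<open>M\<close>.\<close>

lemma compact_subset_of_nearly_full_measure:
  fixes M :: "'a :: polish_space measure"
  assumes "finite_measure M" and sets_M: "sets M = sets (restrict_space borel S)"
    and S: "S \<in> sets borel" and B: "B \<in> sets M" and c: "c < measure M B"
  obtains K where "compact K" "K \<subseteq> B" "K \<in> sets M" "c < measure M K"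
proof (cases "c < 0")
  \<comment> \<open>The empty set suffices for negative \<open>c\<close>; the comparisons in
    \<open>ennreal\<close> below require \<open>0 \<le> c\<close>.\<close>
  case True
  then show ?thesis using that[of "{}"] by simp
next
  case False
  interpret finite_measure M by fact
  define N where "N = distr M borel (\<lambda>x. x)"
  have space_M: "space M = S"
    using sets_eq_imp_space_eq[OF sets_M] by (simp add: space_restrict_space)
  have sets_iff: "A \<in> sets M \<longleftrightarrow> A \<in> sets borel \<and> A \<subseteq> S" for A
    using S unfolding sets_M by (subst sets_restrict_space_iff) auto
  have id: "(\<lambda>x. x) \<in> measurable M borel"
    unfolding measurable_cong_sets[OF sets_M refl] by (intro measurable_restrict_space1) simp
  have N: "emeasure N A = emeasure M A" if "A \<in> sets M" for A
    using that sets.sets_into_space[OF that] id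
    by (simp add: N_def emeasure_distr sets_iff space_M Int_absorb2)
  have "emeasure N (space N) \<noteq> \<infinity>"
    using id by (simp add: N_def emeasure_distr)
  moreover have "sets N = sets borel" by (simp add: N_def)
  ultimately have "emeasure N B = (SUP K\<in>{K. K \<subseteq> B \<and> compact K}. emeasure N K)"
    using B by (intro inner_regular) (simp_all add: sets_iff)
  moreover have "ennreal c < emeasure N B"
    using c False B by (simp add: N emeasure_eq_measure ennreal_less_iff)
  ultimately have "ennreal c < (SUP K\<in>{K. K \<subseteq> B \<and> compact K}. emeasure N K)"
    by (simp only:)
  then obtain K where K: "K \<subseteq> B" "compact K" "ennreal c < emeasure N K"
    unfolding less_SUP_iff by blast
  have "K \<in> sets M"
    using B K borel_compact[OF K(2)] by (auto simp only: sets_iff)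
  moreover from this have "c < measure M K"
    using K(3) False by (simp add: N emeasure_eq_measure ennreal_less_iff)
  ultimately show ?thesis using K that by blast
qed

lemma sphere_probsD:
  assumes "\<mu> \<in> sphere_probs F"
  shows "prob_space \<mu>" "sets \<mu> = sets (restrict_space borel (sphere 0 1))" "space \<mu> = sphere 0 1"
  using assms sets_eq_imp_space_eq[of \<mu> "restrict_space borel (sphere 0 1)"]
  by (auto simp: sphere_probs_def space_restrict_space)

lemma le_energy:
  assumes "energy a \<mu> = ennreal e" "0 \<le> e" "0 \<le> r" "r < 1"
  shows "Re (\<integral>z. (\<integral>w. ui_kernel a (r *\<^sub>R z) (r *\<^sub>R w) \<partial>\<mu>) \<partial>\<mu>) \<le> e"
proof -
  have "ennreal (Re (\<integral>z. (\<integral>w. ui_kernel a (r *\<^sub>R z) (r *\<^sub>R w) \<partial>\<mu>) \<partial>\<mu>)) \<le> energy a \<mu>"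
    unfolding energy_def using assms by (intro SUP_upper) simp
  then show ?thesis using assms by (simp add: ennreal_le_iff)
qed

context regular_unitarily_invariant_space
begin

text \<open>The entry \<open>r = 0\<close> of the supremum equals 1, as the kernel is 1 at the
  origin. This excludes division by zero in \<open>1 / energy a \<mu>\<close>.\<close>

lemma one_le_energy:
  assumes "\<mu> \<in> sphere_probs F"
  shows "1 \<le> energy a \<mu>"
proof -
  interpret prob_space \<mu> using sphere_probsD(1)[OF assms] .
  have "ennreal (Re (\<integral>z. (\<integral>w. ui_kernel a (0 *\<^sub>R z) (0 *\<^sub>R w) \<partial>\<mu>) \<partial>\<mu>)) \<le> energy a \<mu>"
    unfolding energy_def by (rule SUP_upper) simp
  then show ?thesis by (simp add: ui_kernel_zero prob_space)
qed

text \<open>The double integral for the map \<open>\<zeta> \<mapsto> r *\<^sub>R \<zeta>\<close> is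
  one entry of the supremum defining the energy, whence a bound uniform in \<open>r\<close>.\<close>

lemma integral_dilation_le_energy:
  assumes \<mu>: "\<mu> \<in> sphere_probs F" and e: "energy a \<mu> = ennreal e" "0 \<le> e"
    and r: "0 \<le> r" "r < 1" and g: "g \<in> H"
  shows "cmod (\<integral>\<zeta>. g (r *\<^sub>R \<zeta>) \<partial>\<mu>) \<le> ip_norm ip g * sqrt e"
proof -
  interpret prob_space \<mu> using sphere_probsD(1)[OF \<mu>] .
  obtain B where B: "\<And>z w :: complex ^ 'd. \<lbrakk>z \<in> sphere 0 1; w \<in> sphere 0 1\<rbrakk> \<Longrightarrow>
      cmod (ui_kernel a (r *\<^sub>R z) (r *\<^sub>R w)) \<le> B"
    using ui_kernel_dilation_bounded[OF r] by blast
  have "cmod (\<integral>\<zeta>. g (r *\<^sub>R \<zeta>) \<partial>\<mu>)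
      \<le> ip_norm ip g * sqrt (Re (\<integral>z. (\<integral>w. ui_kernel a (r *\<^sub>R z) (r *\<^sub>R w) \<partial>\<mu>) \<partial>\<mu>))"
  proof (rule integral_le_double_integral_kernel[OF finite_measure_axioms _ _ _ g])
    show "r *\<^sub>R \<zeta> \<in> ball 0 1" if "\<zeta> \<in> space \<mu>" for \<zeta>
      using that r scaleR_sphere_in_ball by (simp only: sphere_probsD(3)[OF \<mu>])
    show "(\<lambda>\<zeta>. h (r *\<^sub>R \<zeta>)) \<in> borel_measurable \<mu>" if "h \<in> H" for h
      using borel_measurable_dilation[OF that r]
      by (simp only: measurable_cong_sets[OF sphere_probsD(2)[OF \<mu>] refl])
    show "Re (ui_kernel a (r *\<^sub>R \<zeta>) (r *\<^sub>R \<zeta>)) \<le> B" if "\<zeta> \<in> space \<mu>" for \<zeta>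
      using B[of \<zeta> \<zeta>] that order_trans[OF complex_Re_le_cmod]
      unfolding sphere_probsD(3)[OF \<mu>] by blast
  qed
  also have "\<dots> \<le> ip_norm ip g * sqrt e"
    using le_energy[OF e r] ip_norm_nonneg[OF g] by (intro mult_left_mono real_sqrt_le_mono) auto
  finally show ?thesis .
qed

end

locale positive_real_part_space = regular_unitarily_invariant_space H ip a
  for H :: "(complex ^ 'd \<Rightarrow> complex) set" and ip a +
  assumes Re_kernel_nonneg: "\<lbrakk>z \<in> ball 0 1; w \<in> ball 0 1\<rbrakk> \<Longrightarrow> 0 \<le> Re (ui_kernel a z (w :: complex ^ 'd))"
begin

text \<open>Positivity of the real part enters only here: shrinking a measure does not increase its
  energy before normalisation.\<close>

lemma energy_uniform_measure_le:
  fixes \<mu> :: "(complex ^ 'd) measure"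
  assumes \<mu>: "\<mu> \<in> sphere_probs F" and e: "energy a \<mu> = ennreal e" "0 \<le> e"
    and A: "A \<in> sets \<mu>" and pos: "0 < measure \<mu> A"
  shows "uniform_measure \<mu> A \<in> sphere_probs A"
    and "energy a (uniform_measure \<mu> A) \<le> ennreal (e / (measure \<mu> A)\<^sup>2)"
proof -
  interpret prob_space \<mu> using sphere_probsD(1)[OF \<mu>] .
  note space_\<mu> = sphere_probsD(3)[OF \<mu>]
  have em: "emeasure \<mu> A \<noteq> 0" "emeasure \<mu> A \<noteq> \<infinity>"
    using pos by (simp_all add: emeasure_eq_measure)
  have "emeasure (uniform_measure \<mu> A) (sphere 0 1 - A) = 0"
  proof -
    have "sphere 0 1 - A \<in> sets \<mu>"
      using sets.compl_sets[OF A] by (simp only: space_\<mu>)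
    then show ?thesis using A by (simp add: Diff_disjoint)
  qed
  then show "uniform_measure \<mu> A \<in> sphere_probs A"
    using prob_space_uniform_measure[OF em] sphere_probsD(2)[OF \<mu>]
    by (simp add: sphere_probs_def)
  show "energy a (uniform_measure \<mu> A) \<le> ennreal (e / (measure \<mu> A)\<^sup>2)"
    unfolding energy_def
  proof (rule SUP_least, rule ennreal_leI)
    fix r :: real assume "r \<in> {0..<1}"
    then have r: "0 \<le> r" "r < 1" by auto
    have ball: "r *\<^sub>R \<zeta> \<in> ball 0 1" if "\<zeta> \<in> space \<mu>" for \<zeta>
      using that r scaleR_sphere_in_ball by (simp only: space_\<mu>)
    obtain B where B: "\<And>z w :: complex ^ 'd. \<lbrakk>z \<in> sphere 0 1; w \<in> sphere 0 1\<rbrakk> \<Longrightarrow>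
        cmod (ui_kernel a (r *\<^sub>R z) (r *\<^sub>R w)) \<le> B"
      using ui_kernel_dilation_bounded[OF r] by blast
    have [measurable]: "(\<lambda>x. x) \<in> measurable \<mu> borel"
      unfolding measurable_cong_sets[OF sphere_probsD(2)[OF \<mu>] refl]
      by (intro measurable_restrict_space1) simp
    \<comment> \<open>The kernel is Borel on the product space; \<open>borel_prod\<close> identifies
      that structure with the product of the Borel structures.\<close>
    have "(\<lambda>p. (r *\<^sub>R fst p, r *\<^sub>R snd p)) \<in> measurable (\<mu> \<Otimes>\<^sub>M \<mu>) (borel \<Otimes>\<^sub>M borel)"
      by measurable
    then have "(\<lambda>p. (r *\<^sub>R fst p, r *\<^sub>R snd p)) \<in> borel_measurable (\<mu> \<Otimes>\<^sub>M \<mu>)"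
      by (simp add: borel_prod)
    from measurable_compose[OF this borel_measurable_ui_kernel]
    have "(\<lambda>p. ui_kernel a (r *\<^sub>R fst p) (r *\<^sub>R snd p)) \<in> borel_measurable (\<mu> \<Otimes>\<^sub>M \<mu>)"
      by simp
    then have "Re (\<integral>z. (\<integral>w. ui_kernel a (r *\<^sub>R z) (r *\<^sub>R w) \<partial>uniform_measure \<mu> A) \<partial>uniform_measure \<mu> A)
        \<le> Re (\<integral>z. (\<integral>w. ui_kernel a (r *\<^sub>R z) (r *\<^sub>R w) \<partial>\<mu>) \<partial>\<mu>) / (measure \<mu> A)\<^sup>2"
      using B ball Re_kernel_nonneg
      by (intro double_integral_uniform_measure_le[OF finite_measure_axioms A pos]) (simp_all only: space_\<mu>)
    also have "\<dots> \<le> e / (measure \<mu> A)\<^sup>2"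
      using le_energy[OF e r] by (rule divide_right_mono) simp
    finally show "Re (\<integral>z. (\<integral>w. ui_kernel a (r *\<^sub>R z) (r *\<^sub>R w) \<partial>uniform_measure \<mu> A) \<partial>uniform_measure \<mu> A)
        \<le> e / (measure \<mu> A)\<^sup>2" .
  qed
qed

section \<open>Weak-type bounds and domination of measure by capacity\<close>

text \<open>The average of \<open>Re (g (r *\<^sub>R \<zeta>))\<close> over \<open>A\<close> is at
  least \<open>M\<close>. It is also at most the norm of \<open>g\<close> times the root of the
  energy of the normalised restriction, that is, \<open>sqrt e / measure \<mu> A\<close>.\<close>

lemma measure_Re_dilation_ge:
  fixes \<mu> :: "(complex ^ 'd) measure"
  assumes \<mu>: "\<mu> \<in> sphere_probs F" and e: "energy a \<mu> = ennreal e" "0 \<le> e"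
    and r: "0 \<le> r" "r < 1" and g: "g \<in> H"
    and A: "A \<in> sets \<mu>" and M: "\<And>\<zeta>. \<zeta> \<in> A \<Longrightarrow> M \<le> Re (g (r *\<^sub>R \<zeta>))"
  shows "M * measure \<mu> A \<le> ip_norm ip g * sqrt e"
proof (cases "measure \<mu> A = 0")
  case True
  then show ?thesis using ip_norm_nonneg[OF g] e by simp
next
  case False
  then have pos: "0 < measure \<mu> A" using measure_nonneg[of \<mu> A] by linarith
  let ?\<nu> = "uniform_measure \<mu> A"
  note \<nu> = energy_uniform_measure_le[OF \<mu> e A pos]
  interpret prob_space ?\<nu> using sphere_probsD(1)[OF \<nu>(1)] .
  obtain d where d: "energy a ?\<nu> = ennreal d" "0 \<le> d" "d \<le> e / (measure \<mu> A)\<^sup>2"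
    using \<nu>(2) e by (cases "energy a ?\<nu>") (auto simp: top_unique ennreal_le_iff)
  have meas: "(\<lambda>\<zeta>. g (r *\<^sub>R \<zeta>)) \<in> borel_measurable ?\<nu>"
    using borel_measurable_dilation[OF g r]
    by (simp only: measurable_cong_sets[OF sphere_probsD(2)[OF \<nu>(1)] refl])
  obtain B where B: "\<And>\<zeta>. \<zeta> \<in> sphere 0 1 \<Longrightarrow> cmod (g (r *\<^sub>R \<zeta>)) \<le> B"
  proof -
    have "continuous_on (sphere 0 1) (\<lambda>\<zeta>. g (r *\<^sub>R \<zeta>))"
      using scaleR_sphere_in_ball[OF r]
      by (intro continuous_on_compose2[OF continuous_on_member[OF g]] continuous_intros) blast
    then have "bounded ((\<lambda>\<zeta>. g (r *\<^sub>R \<zeta>)) ` sphere 0 1)"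
      by (intro compact_imp_bounded compact_continuous_image compact_sphere)
    then show ?thesis using that by (auto simp only: bounded_iff ball_simps)
  qed
  have int: "integrable ?\<nu> (\<lambda>\<zeta>. g (r *\<^sub>R \<zeta>))"
    using meas B by (intro integrable_const_bound[where B = B] AE_I2) (simp_all only: sphere_probsD(3)[OF \<nu>(1)])
  have "M \<le> (\<integral>\<zeta>. Re (g (r *\<^sub>R \<zeta>)) \<partial>?\<nu>)"
    using M A int by (intro integral_ge_const AE_uniform_measureI integrable_Re) auto
  also have "\<dots> = Re (\<integral>\<zeta>. g (r *\<^sub>R \<zeta>) \<partial>?\<nu>)"
    using int by (rule integral_Re)
  also have "\<dots> \<le> cmod (\<integral>\<zeta>. g (r *\<^sub>R \<zeta>) \<partial>?\<nu>)" by (rule complex_Re_le_cmod)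
  also have "\<dots> \<le> ip_norm ip g * sqrt d"
    by (rule integral_dilation_le_energy[OF \<nu>(1) d(1,2) r g])
  also have "\<dots> \<le> ip_norm ip g * (sqrt e / measure \<mu> A)"
    using real_sqrt_le_mono[OF d(3)] pos ip_norm_nonneg[OF g]
    by (intro mult_left_mono) (simp_all add: real_sqrt_divide)
  finally show ?thesis using pos by (simp add: field_simps)
qed

text \<open>A complex number of modulus at least \<open>M\<close> has one of its real and imaginary
  parts, up to sign, at least \<open>M / 2\<close>. Rotation by 1, -1, \<open>\<i>\<close> and
  \<open>-\<i>\<close> makes each case a real-part bound; four sets with a factor 2 each give the
  constant 8.\<close>

lemma measure_cmod_dilation_ge:
  fixes \<mu> :: "(complex ^ 'd) measure"
  assumes \<mu>: "\<mu> \<in> sphere_probs F" and e: "energy a \<mu> = ennreal e" "0 \<le> e"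
    and r: "0 \<le> r" "r < 1" and g: "g \<in> H" and M: "0 \<le> M"
  shows "M * measure \<mu> {\<zeta> \<in> sphere 0 1. M \<le> cmod (g (r *\<^sub>R \<zeta>))} \<le> 8 * ip_norm ip g * sqrt e"
proof -
  interpret prob_space \<mu> using sphere_probsD(1)[OF \<mu>] .
  have [measurable]: "(\<lambda>\<zeta>. g (r *\<^sub>R \<zeta>)) \<in> borel_measurable \<mu>"
    using borel_measurable_dilation[OF g r]
    by (simp only: measurable_cong_sets[OF sphere_probsD(2)[OF \<mu>] refl])
  define A where "A c = {\<zeta> \<in> space \<mu>. M / 2 \<le> Re (c * g (r *\<^sub>R \<zeta>))}" for c
  have A[measurable]: "A c \<in> sets \<mu>" for c unfolding A_def by measurable
  have bound: "M / 2 * measure \<mu> (A c) \<le> ip_norm ip g * sqrt e" if "cmod c = 1" for c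
    using measure_Re_dilation_ge[OF \<mu> e r scale_closed[OF g, of c] A[of c], of "M / 2"] that
    by (simp add: A_def ip_norm_scale[OF g])
  let ?U = "(A 1 \<union> A (-1)) \<union> (A \<i> \<union> A (-\<i>))"
  have "{\<zeta> \<in> sphere 0 1. M \<le> cmod (g (r *\<^sub>R \<zeta>))} \<subseteq> ?U"
  proof
    fix \<zeta> assume "\<zeta> \<in> {\<zeta> \<in> sphere 0 1. M \<le> cmod (g (r *\<^sub>R \<zeta>))}"
    then have "\<zeta> \<in> space \<mu>" "M \<le> \<bar>Re (g (r *\<^sub>R \<zeta>))\<bar> + \<bar>Im (g (r *\<^sub>R \<zeta>))\<bar>"
      using cmod_le[of "g (r *\<^sub>R \<zeta>)"] unfolding sphere_probsD(3)[OF \<mu>] by auto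
    then show "\<zeta> \<in> ?U" by (auto simp: A_def)
  qed
  then have "measure \<mu> {\<zeta> \<in> sphere 0 1. M \<le> cmod (g (r *\<^sub>R \<zeta>))} \<le> measure \<mu> ?U"
    by (intro finite_measure_mono) auto
  also have "\<dots> \<le> (measure \<mu> (A 1) + measure \<mu> (A (-1))) + (measure \<mu> (A \<i>) + measure \<mu> (A (-\<i>)))"
    by (intro order_trans[OF measure_Un_le] add_mono) auto
  finally have "M * measure \<mu> {\<zeta> \<in> sphere 0 1. M \<le> cmod (g (r *\<^sub>R \<zeta>))}
      \<le> M * ((measure \<mu> (A 1) + measure \<mu> (A (-1))) + (measure \<mu> (A \<i>) + measure \<mu> (A (-\<i>))))"
    using M by (rule mult_left_mono)
  with bound[of 1] bound[of "-1"] bound[of \<i>] bound[of "-\<i>"] show ?thesis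
    by (simp add: algebra_simps)
qed

text \<open>For compact \<open>K\<close> inside an open \<open>G\<close>, the normalised restriction
  to \<open>K\<close> is a competitor for the capacity of \<open>K\<close>, with reciprocal energy
  at least \<open>(measure \<mu> K)\<^sup>2 / e\<close>. Inner regularity then replaces
  \<open>K\<close> by \<open>G\<close>.\<close>

lemma measure_square_le_outer_cap:
  fixes \<mu> :: "(complex ^ 'd) measure"
  assumes \<mu>: "\<mu> \<in> sphere_probs F" and e: "energy a \<mu> = ennreal e" "0 < e"
  shows "ennreal ((measure \<mu> E)\<^sup>2 / e) \<le> outer_cap a E"
  unfolding outer_cap_def
proof (rule INF_greatest)
  interpret prob_space \<mu> using sphere_probsD(1)[OF \<mu>] .
  fix G assume "G \<in> {G. openin (top_of_set (sphere 0 1)) G \<and> E \<subseteq> G}"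
  then obtain U where U: "open U" "G = sphere 0 1 \<inter> U" and EG: "E \<subseteq> G"
    by (auto simp: openin_open)
  have G: "G \<in> sets \<mu>"
    unfolding sphere_probsD(2)[OF \<mu>] sets_restrict_space U(2)
    using borel_open[OF U(1)] by (rule imageI)
  have "ennreal (c\<^sup>2 / e) \<le> inner_cap a G" if c: "0 < c" "c < measure \<mu> G" for c
  proof -
    obtain K where K: "compact K" "K \<subseteq> G" "K \<in> sets \<mu>" "c < measure \<mu> K"
      using compact_subset_of_nearly_full_measure[OF finite_measure_axioms sphere_probsD(2)[OF \<mu>] _ G c(2)]
      by (auto simp: borel_closed)
    have pos: "0 < measure \<mu> K" using K c by simp
    note \<nu> = energy_uniform_measure_le[OF \<mu> e(1) less_imp_le[OF e(2)] K(3) pos]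
    have "c\<^sup>2 \<le> (measure \<mu> K)\<^sup>2" using K c by (intro power_mono) auto
    then have "ennreal (c\<^sup>2 / e) \<le> ennreal ((measure \<mu> K)\<^sup>2 / e)"
      using e by (intro ennreal_leI divide_right_mono) auto
    also have "\<dots> \<le> 1 / energy a (uniform_measure \<mu> K)"
    proof -
      obtain d where d: "energy a (uniform_measure \<mu> K) = ennreal d" "0 \<le> d" "d \<le> e / (measure \<mu> K)\<^sup>2"
        using \<nu>(2) e by (cases "energy a (uniform_measure \<mu> K)") (auto simp: top_unique ennreal_le_iff)
      have "1 \<le> d" using one_le_energy[OF \<nu>(1)] d by (simp flip: ennreal_1 add: ennreal_le_iff)
      then have "(measure \<mu> K)\<^sup>2 / e \<le> 1 / d" using d(3) e pos by (simp add: field_simps)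
      then have "ennreal ((measure \<mu> K)\<^sup>2 / e) \<le> ennreal (1 / d)" by (rule ennreal_leI)
      then show ?thesis using \<open>1 \<le> d\<close> d divide_ennreal[of 1 d] by simp
    qed
    also have "\<dots> \<le> compact_cap a K"
      unfolding compact_cap_def using \<nu>(1) by (rule SUP_upper)
    also have "\<dots> \<le> inner_cap a G"
      unfolding inner_cap_def using K by (intro SUP_upper) simp
    finally show ?thesis .
  qed
  note bound = this
  \<comment> \<open>Let \<open>c\<close> increase to \<open>measure \<mu> G\<close>; a left
    neighbourhood of positive \<open>c\<close> exists only if that measure is non-zero.\<close>
  have "ennreal ((measure \<mu> G)\<^sup>2 / e) \<le> inner_cap a G"
  proof (cases "measure \<mu> G = 0")
    case False
    then have pos: "0 < measure \<mu> G" using measure_nonneg[of \<mu> G] by linarith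
    have "((\<lambda>c. ennreal (c\<^sup>2 / e)) \<longlongrightarrow> ennreal ((measure \<mu> G)\<^sup>2 / e)) (at_left (measure \<mu> G))"
      using e by (intro tendsto_intros) auto
    moreover have "\<forall>\<^sub>F c in at_left (measure \<mu> G). ennreal (c\<^sup>2 / e) \<le> inner_cap a G"
      using eventually_at_left_field pos bound by blast
    ultimately show ?thesis by (intro tendsto_upperbound) auto
  qed simp
  \<comment> \<open>A non-measurable \<open>E\<close> has measure 0 by convention, so monotonicity
    covers it too.\<close>
  moreover have "(measure \<mu> E)\<^sup>2 / e \<le> (measure \<mu> G)\<^sup>2 / e"
    using finite_measure_mono[OF EG G] e by (intro divide_right_mono power_mono) auto
  ultimately show "ennreal ((measure \<mu> E)\<^sup>2 / e) \<le> inner_cap a G"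
    using ennreal_leI order_trans by blast
qed

section \<open>Measures carried by the zero set\<close>

lemma energy_infinite_on_zero_set:
  fixes \<mu> :: "(complex ^ 'd) measure"
  assumes cyc: "cyclic (ball 0 1) H ip f" and bf: "boundary_function a f fs"
    and F: "F \<in> sets borel" "F \<subseteq> {\<zeta> \<in> sphere 0 1. fs \<zeta> = 0}" and \<mu>: "\<mu> \<in> sphere_probs F"
  shows "energy a \<mu> = \<infinity>"
proof (rule ccontr)
  assume "energy a \<mu> \<noteq> \<infinity>"
  then obtain e where e: "energy a \<mu> = ennreal e" "0 \<le> e"
    by (cases "energy a \<mu>") auto
  have "1 \<le> e" using one_le_energy[OF \<mu>] e by (simp flip: ennreal_1 add: ennreal_le_iff)
  interpret prob_space \<mu> using sphere_probsD(1)[OF \<mu>] .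
  let ?one = "on_set (ball 0 1) (\<lambda>z :: complex ^ 'd. 1)"
  have f: "f \<in> H" using cyc by (simp add: cyclic_def)
  \<comment> \<open>With 64, the weak-type bound at level 1/2 leaves the error set \<open>?A\<close>
    measure below 1/4.\<close>
  have "0 < 1 / (64 * sqrt e)" using \<open>1 \<le> e\<close> by simp
  with cyc one_mem obtain \<phi> where \<phi>: "\<phi> \<in> Mult (ball 0 1) H"
    and small: "ip_norm ip (\<lambda>x. \<phi> x * f x - ?one x) < 1 / (64 * sqrt e)"
    unfolding cyclic_def by blast
  have \<phi>_mem: "\<phi> \<in> H" using \<phi> by (rule Mult_subset)
  have \<phi>f: "(\<lambda>x. \<phi> x * f x) \<in> H" using \<phi> f by (simp add: Mult_def)
  let ?err = "\<lambda>x. \<phi> x * f x - ?one x"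
  have err: "?err \<in> H" using diff_closed[OF \<phi>f one_mem] .
  \<comment> \<open>The factor 32 is four times the weak-type constant 8, so \<open>?B\<close> has
    measure below 1/4; the summand 1 keeps \<open>M\<close> positive.\<close>
  define M where "M = 1 + 32 * ip_norm ip \<phi> * sqrt e"
  have M: "1 \<le> M" "32 * ip_norm ip \<phi> * sqrt e < M"
    using ip_norm_nonneg[OF \<phi>_mem] e by (simp_all add: M_def)
  \<comment> \<open>Where \<open>fs\<close> vanishes and \<phi> is below \<open>M\<close>, this
    threshold keeps the product with \<open>f\<close> at most 1/2.\<close>
  define E where "E r = {\<zeta> \<in> sphere 0 1. cmod (fs \<zeta> - f (r *\<^sub>R \<zeta>)) \<ge> 1 / (2 * M)}" for r
  have "((\<lambda>r. outer_cap a (E r)) \<longlongrightarrow> 0) (at_left 1)"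
    using bf M unfolding boundary_function_def E_def by simp
  \<comment> \<open>Capacity below \<open>1 / (16 * e)\<close> forces the measure of
    \<open>E r\<close> below 1/4. The radius is chosen after \<phi> and \<open>M\<close>, which is
    possible because the bounds for \<open>?A\<close> and \<open>?B\<close> hold at every
    radius.\<close>
  then have "\<forall>\<^sub>F r in at_left 1. outer_cap a (E r) < ennreal (1 / (16 * e))"
    using \<open>1 \<le> e\<close> by (intro order_tendstoD) auto
  moreover have "\<forall>\<^sub>F r in at_left 1. r \<in> {0<..<1::real}"
    by (rule eventually_at_leftI[of 0]) auto
  ultimately have "\<forall>\<^sub>F r in at_left 1. outer_cap a (E r) < ennreal (1 / (16 * e)) \<and> r \<in> {0<..<1}"
    by (rule eventually_conj)
  then obtain r where cap: "outer_cap a (E r) < ennreal (1 / (16 * e))" and r: "0 \<le> r" "r < 1"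
    using eventually_happens'[OF trivial_limit_at_left_real] by force
  let ?A = "{\<zeta> \<in> sphere 0 1. 1 / 2 \<le> cmod (?err (r *\<^sub>R \<zeta>))}"
  let ?B = "{\<zeta> \<in> sphere 0 1. M \<le> cmod (\<phi> (r *\<^sub>R \<zeta>))}"
  have meas[measurable]: "(\<lambda>\<zeta>. h (r *\<^sub>R \<zeta>)) \<in> borel_measurable \<mu>" if "h \<in> H" for h
    using borel_measurable_dilation[OF that r]
    by (simp only: measurable_cong_sets[OF sphere_probsD(2)[OF \<mu>] refl])
  have fs: "fs \<in> borel_measurable \<mu>"
    using bf unfolding boundary_function_def
    by (simp only: measurable_cong_sets[OF sphere_probsD(2)[OF \<mu>] refl])
  have sets: "?A \<in> sets \<mu>" "?B \<in> sets \<mu>" "E r \<in> sets \<mu>"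
    using meas[OF err] meas[OF \<phi>_mem] meas[OF f] fs unfolding E_def sphere_probsD(3)[OF \<mu>, symmetric]
    by measurable
  have FS: "sphere 0 1 - F \<in> sets \<mu>"
    unfolding sphere_probsD(3)[OF \<mu>, symmetric]
  proof (rule sets.compl_sets)
    show "F \<in> sets \<mu>"
      unfolding sphere_probsD(2)[OF \<mu>] sets_restrict_space
      using F by (intro image_eqI[of F _ F]) auto
  qed
  have A: "measure \<mu> ?A < 1 / 4"
  proof -
    have "1 / 2 * measure \<mu> ?A \<le> 8 * ip_norm ip ?err * sqrt e"
      by (rule measure_cmod_dilation_ge[OF \<mu> e r err]) simp
    also have "\<dots> < 1 / 8"
      using small \<open>1 \<le> e\<close> by (simp add: field_simps)
    finally show ?thesis by simp
  qed
  have B: "measure \<mu> ?B < 1 / 4"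
  proof -
    have "M * measure \<mu> ?B \<le> 8 * ip_norm ip \<phi> * sqrt e"
      using M by (intro measure_cmod_dilation_ge[OF \<mu> e r \<phi>_mem]) simp
    also have "\<dots> < M * (1 / 4)" using M by simp
    finally show ?thesis using M by simp
  qed
  have E: "measure \<mu> (E r) < 1 / 4"
  proof -
    have "ennreal ((measure \<mu> (E r))\<^sup>2 / e) < ennreal (1 / (16 * e))"
      using measure_square_le_outer_cap[OF \<mu> e(1)] \<open>1 \<le> e\<close> cap
      by (intro le_less_trans[OF _ cap]) simp
    then have "(measure \<mu> (E r))\<^sup>2 < (1 / 4)\<^sup>2"
      using \<open>1 \<le> e\<close> by (simp add: ennreal_less_iff field_simps power2_eq_square)
    then show ?thesis by (rule power_less_imp_less_base) simp
  qed
  \<comment> \<open>Off these sets the product is at most 1/2 in modulus, yet closer than 1/2 to 1.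
    The covering contradicts total mass 1: one set is null, the other three have measure below
    1/4.\<close>
  have "space \<mu> \<subseteq> ((sphere 0 1 - F) \<union> ?A) \<union> (?B \<union> E r)"
  proof
    fix \<zeta> assume "\<zeta> \<in> space \<mu>"
    then have \<zeta>: "\<zeta> \<in> sphere 0 1" by (simp only: sphere_probsD(3)[OF \<mu>])
    show "\<zeta> \<in> ((sphere 0 1 - F) \<union> ?A) \<union> (?B \<union> E r)"
    proof (rule ccontr)
      assume "\<not> ?thesis"
      then have "\<zeta> \<in> F" and 1: "cmod (?err (r *\<^sub>R \<zeta>)) < 1 / 2" and 2: "cmod (\<phi> (r *\<^sub>R \<zeta>)) < M"
        and 3: "cmod (fs \<zeta> - f (r *\<^sub>R \<zeta>)) < 1 / (2 * M)"
        using \<zeta> unfolding E_def by auto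
      have "cmod (f (r *\<^sub>R \<zeta>)) < 1 / (2 * M)"
        using 3 F \<open>\<zeta> \<in> F\<close> by (auto simp: subset_iff)
      with 2 have "cmod (\<phi> (r *\<^sub>R \<zeta>) * f (r *\<^sub>R \<zeta>)) \<le> M * (1 / (2 * M))"
        unfolding norm_mult using M by (intro mult_mono) auto
      then have "cmod (\<phi> (r *\<^sub>R \<zeta>) * f (r *\<^sub>R \<zeta>)) \<le> 1 / 2" using M by simp
      moreover have "?one (r *\<^sub>R \<zeta>) = 1"
        using scaleR_sphere_in_ball[OF r \<zeta>] by (simp add: on_set_def)
      ultimately show False
        using 1 norm_triangle_ineq2[of 1 "\<phi> (r *\<^sub>R \<zeta>) * f (r *\<^sub>R \<zeta>)"]
        by (simp add: norm_minus_commute)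
    qed
  qed
  then have "measure \<mu> (space \<mu>) \<le> measure \<mu> (((sphere 0 1 - F) \<union> ?A) \<union> (?B \<union> E r))"
    by (rule finite_measure_mono) (intro sets.Un sets FS)
  also have "\<dots> \<le> measure \<mu> ((sphere 0 1 - F) \<union> ?A) + measure \<mu> (?B \<union> E r)"
    by (intro measure_Un_le sets.Un sets FS)
  also have "\<dots> \<le> (measure \<mu> (sphere 0 1 - F) + measure \<mu> ?A) + (measure \<mu> ?B + measure \<mu> (E r))"
    by (intro add_mono measure_Un_le sets FS)
  also have "measure \<mu> (sphere 0 1 - F) = 0"
    using \<mu> by (simp add: sphere_probs_def measure_def)
  finally show False using A B E unfolding prob_space by linarith
qed

end

theorem corollary6p6:
  fixes H :: "(complex ^ 'd \<Rightarrow> complex) set"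
    and ip :: "(complex ^ 'd \<Rightarrow> complex) \<Rightarrow> (complex ^ 'd \<Rightarrow> complex) \<Rightarrow> complex"
    and a :: "nat \<Rightarrow> real"
    and f fs :: "complex ^ 'd \<Rightarrow> complex"
  assumes "regular_unitarily_invariant_space H ip a"
    and "\<And>z w. z \<in> ball 0 1 \<Longrightarrow> w \<in> ball 0 1 \<Longrightarrow> 0 \<le> Re (ui_kernel a z (w :: complex ^ 'd))"
    and "cyclic (ball 0 1) H ip f"
    and "boundary_function a f fs"
  shows "inner_cap a {\<zeta> \<in> sphere 0 1. fs \<zeta> = 0} = 0"
proof -
  interpret positive_real_part_space H ip a
    using assms(1,2) by (intro positive_real_part_space.intro positive_real_part_space_axioms.intro)
  \<comment> \<open>Infinite energy makes each competitor contribute 0, so every compact subset of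
    the zero set has capacity 0.\<close>
  have "1 / energy a \<mu> = 0"
    if "compact F" "F \<subseteq> {\<zeta> \<in> sphere 0 1. fs \<zeta> = 0}" "\<mu> \<in> sphere_probs F" for F and \<mu> :: "(complex ^ 'd) measure"
    using energy_infinite_on_zero_set[OF assms(3,4) _ that(2,3)] that(1)
    by (simp add: borel_closed compact_imp_closed)
  then have "compact_cap a F = 0" if "compact F" "F \<subseteq> {\<zeta> \<in> sphere 0 1. fs \<zeta> = 0}" for F
    unfolding compact_cap_def using that by (intro antisym SUP_least) auto
  then show ?thesis
    unfolding inner_cap_def by (intro antisym SUP_least) auto
qed

end
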